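(* Let $N\ge2$ and $N_\theta\ge1$ be integers, let $x^{(1)},\dots,x^{(N)}\in\mathbb{R}^{N_\theta}$ and $\widehat x^{(1)},\dots,\widehat x^{(N)}\in\mathbb{R}^{N_\theta}$, and put $\widetilde e^{(s)}=\widehat x^{(s)}-x^{(s)}$. Define $$\widehat\Sigma_N=\frac1{N-1}\sum_{s=1}^N x^{(s)}x^{(s)\top},\qquad \widehat\Sigma_N^{\mathrm{rec}}=\frac1{N-1}\sum_{s=1}^N\widehat x^{(s)}\widehat x^{(s)\top}.$$ Assume there exist constants $M_x>0$ and $\varepsilon>0$ such that $$\frac1N\sum_{s=1}^N\|x^{(s)}\|_2^2\le M_x,\qquad \frac1N\sum_{s=1}^N\|\widetilde e^{(s)}\|_2^2\le\varepsilon^2 .$$ Then $$\big\|\widehat\Sigma_N^{\mathrm{rec}}-\widehat\Sigma_N\big\|_2\le\frac{N}{N-1}\big(2\sqrt{M_x}\,\varepsilon+\varepsilon^2\big),$$ and consequently, for all $j$, the eigenvalues $\widehat\mu_j$ of $\widehat\Sigma_N$ and $\widehat\mu_j^{\mathrm{rec}}$ of $\widehat\Sigma_N^{\mathrm{rec}}$ satisfy $$\big|\widehat\mu_j^{\mathrm{rec}}-\widehat\mu_j\big|\le\frac{N}{N-1}\big(2\sqrt{M_x}\,\varepsilon+\varepsilon^2\big).$$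
   Context: Here $x^{(s)}$ is the true boundary fluctuation of sample $s$ discretised on a grid of $N_\theta$ angles, $\widehat x^{(s)}$ is its reconstruction, and $\widetilde e^{(s)}$ is the reconstruction error. $\|\cdot\|_2$ is the Euclidean norm for vectors and the spectral (operator) norm for matrices. The eigenvalues of each symmetric matrix are counted with multiplicity and listed in non-increasing order. *)

theory Defs
  imports "HOL-Analysis.Analysis" "HOL-Computational_Algebra.Polynomial"
begin

definition outer :: "real ^ 'n \<Rightarrow> real ^ 'n \<Rightarrow> real ^ 'n ^ 'n" where
  "outer u v = (\<chi> i j. u $ i * v $ j)"

text \<open>No sample mean is subtracted, although the normalisation is by \<open>N - 1\<close>.\<close>

definition sample_cov :: "nat \<Rightarrow> (nat \<Rightarrow> real ^ 'n) \<Rightarrow> real ^ 'n ^ 'n" where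
  "sample_cov N x = (1 / (real N - 1)) *\<^sub>R (\<Sum>s=1..N. outer (x s) (x s))"

text \<open>The characteristic polynomial \<open>det (X I - A)\<close>, as a determinant over the polynomial ring.\<close>

definition charpoly :: "real ^ 'n ^ 'n \<Rightarrow> real poly" where
  "charpoly A = det (mat [:0, 1:] - (\<chi> i j. [:A $ i $ j:]))"

text \<open>
  The real eigenvalues with multiplicity, in non-increasing order. For symmetric \<open>A\<close> all
  roots of \<open>charpoly A\<close> are real, so the list has length \<open>CARD('n)\<close>.
\<close>

definition eigenvalues :: "real ^ 'n ^ 'n \<Rightarrow> real list" where
  "eigenvalues A = rev (sorted_list_of_multiset (proots (charpoly A)))"

lemma poly_det: "poly (det B) t = det (\<chi> i j. poly (B $ i $ j) t)"
  for B :: "real poly ^ 'n ^ 'n"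
  by (simp add: det_def poly_sum poly_prod)

lemma poly_charpoly: "poly (charpoly A) t = det (mat t - A)"
  unfolding charpoly_def poly_det
  by (rule arg_cong[of _ _ det]) (simp add: vec_eq_iff mat_def)

lemma poly_charpoly_eq_0_iff: "poly (charpoly A) t = 0 \<longleftrightarrow> (\<exists>v. v \<noteq> 0 \<and> A *v v = t *\<^sub>R v)"
  for A :: "real ^ 'n ^ 'n"
proof -
  have "(mat t - A) *v v = t *\<^sub>R v - A *v v" for v :: "real ^ 'n"
  proof -
    have "mat t = t *\<^sub>R (mat 1 :: real ^ 'n ^ 'n)"
      by (simp add: vec_eq_iff mat_def)
    then show ?thesis
      by (simp add: matrix_vector_mult_diff_rdistrib scaleR_matrix_vector_assoc[symmetric])
  qed
  then show ?thesis
    unfolding poly_charpoly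
    using invertible_det_nz[of "mat t - A"] matrix_left_invertible_ker[of "mat t - A"]
    by (auto simp: invertible_left_inverse)
qed

lemma charpoly_nonzero: "charpoly A \<noteq> 0"
  for A :: "real ^ 'n ^ 'n"
proof
  assume "charpoly A = 0"
  then obtain v where v: "v \<noteq> 0" "A *v v = (onorm ((*v) A) + 1) *\<^sub>R v"
    using poly_charpoly_eq_0_iff[of A "onorm ((*v) A) + 1"] by auto
  have "norm (A *v v) \<le> onorm ((*v) A) * norm v"
    by (rule onorm) (rule matrix_vector_mul_bounded_linear)
  moreover have "0 \<le> onorm ((*v) A)"
    by (rule onorm_pos_le) (rule matrix_vector_mul_bounded_linear)
  ultimately show False
    using v by (simp add: distrib_right)
qed

lemma set_eigenvalues: "set (eigenvalues A) = {t. \<exists>v. v \<noteq> 0 \<and> A *v v = t *\<^sub>R v}"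
  by (simp add: eigenvalues_def charpoly_nonzero poly_charpoly_eq_0_iff)

end

theory Submission
  imports Defs
begin

text \<open>
  Write \<open>y = x + e\<close> for a reconstructed sample. Then
  \<open>y y\<^sup>T - x x\<^sup>T = x e\<^sup>T + e x\<^sup>T + e e\<^sup>T\<close>, an operator of norm at most
  \<open>2 \<bar>x\<bar> \<bar>e\<bar> + \<bar>e\<bar>\<^sup>2\<close> (\<open>norm_rank_one_perturbation\<close>). Summing over the samples and applying
  Cauchy--Schwarz to \<open>\<Sum>\<^sub>s \<bar>x\<^sub>s\<bar> \<bar>e\<^sub>s\<bar>\<close> gives the bound on the operator norm
  (\<open>sample_cov_perturbation\<close>).

  The eigenvalue bound is then Weyl's perturbation inequality (\<open>weyl_perturbation\<close>): the \<open>j\<close>-th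
  largest eigenvalues of two self-adjoint matrices differ by at most the operator norm of the
  difference. Let \<open>S\<close> be spanned by eigenvectors for all but the \<open>j\<close> largest eigenvalues of \<open>A\<close>,
  and \<open>T\<close> by eigenvectors for the \<open>j + 1\<close> largest eigenvalues of \<open>B\<close>. The dimensions add up to
  \<open>n + 1\<close>, so the subspaces share a nonzero vector \<open>v\<close>, and comparing the Rayleigh quotients of
  \<open>A\<close> and \<open>B\<close> at \<open>v\<close> bounds the difference of the eigenvalues.

  This argument needs an orthonormal eigenbasis in which the eigenvalues occur exactly as the roots
  of the characteristic polynomial, with multiplicity and in order
  (\<open>spectral_theorem_eigenvalues\<close>). The eigenbasis comes from maximising the Rayleigh quotient
  repeatedly on orthogonal complements; changing to it diagonalises \<open>t I - A\<close> for every \<open>t\<close>, which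
  factors the characteristic polynomial.
\<close>

section \<open>Orthonormal eigenbases of self-adjoint operators\<close>

text \<open>
  A maximiser \<open>v\<close> of the Rayleigh quotient on the unit sphere of the subspace is an eigenvector. With
  \<open>\<mu>\<close> the maximum, the quadratic form \<open>q u = \<mu> (u \<bullet> u) - u \<bullet> f u\<close> is nonnegative on the subspace
  and vanishes at \<open>v\<close>, so its derivative at \<open>v\<close> in the direction of the residual
  \<open>r = \<mu> v - f v\<close>, which is \<open>2 (r \<bullet> r)\<close>, must be zero.
\<close>

lemma self_adjoint_eigenvector_in_subspace:
  fixes f :: "'a::euclidean_space \<Rightarrow> 'a"
  assumes f: "linear f" and adj: "\<And>u w. f u \<bullet> w = u \<bullet> f w"
    and S: "subspace S" "f ` S \<subseteq> S" "S \<noteq> {0}"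
  obtains v \<mu> where "v \<in> S" "norm v = 1" "f v = \<mu> *\<^sub>R v"
proof -
  let ?K = "sphere 0 1 \<inter> S"
  have "compact ?K"
    by (intro compact_Int_closed closed_subspace S compact_sphere)
  moreover have "?K \<noteq> {}"
  proof -
    obtain w where w: "w \<in> S" "w \<noteq> 0"
      using S subspace_0 by blast
    then have "(1 / norm w) *\<^sub>R w \<in> ?K"
      using S by (simp add: subspace_scale)
    then show ?thesis by blast
  qed
  moreover have "continuous_on ?K (\<lambda>u. u \<bullet> f u)"
    by (intro continuous_intros linear_continuous_on) (use f in \<open>simp add: linear_conv_bounded_linear\<close>)
  ultimately obtain v where v: "v \<in> ?K" and max: "\<And>u. u \<in> ?K \<Longrightarrow> u \<bullet> f u \<le> v \<bullet> f v"
    using continuous_attains_sup[of ?K "\<lambda>u. u \<bullet> f u"] by blast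
  define \<mu> where "\<mu> = v \<bullet> f v"
  define r where "r = \<mu> *\<^sub>R v - f v"
  define q where "q u = \<mu> * (u \<bullet> u) - u \<bullet> f u" for u
  have vv: "v \<bullet> v = 1" using v by (simp add: norm_eq_1)
  have nonneg: "0 \<le> q u" if "u \<in> S" for u
  proof (cases "u = 0")
    case False
    have "(1 / norm u) *\<^sub>R u \<in> ?K"
      using that S False by (simp add: subspace_scale)
    from max[OF this] have "u \<bullet> f u / (norm u)\<^sup>2 \<le> \<mu>"
      by (simp add: linear_scale[OF f] \<mu>_def power2_eq_square)
    then show ?thesis
      using False by (simp add: q_def dot_square_norm divide_simps mult.commute)
  qed (simp add: q_def)
  have r: "r \<in> S"
    using v S by (auto simp: r_def intro!: subspace_diff subspace_scale)
  have expand: "q (v + t *\<^sub>R r) = 2 * t * (r \<bullet> r) + t\<^sup>2 * q r" for t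
  proof -
    have "v \<bullet> f r = r \<bullet> f v" using adj[of v r] by (simp add: inner_commute)
    moreover have "r \<bullet> r = \<mu> * (r \<bullet> v) - r \<bullet> f v"
      by (subst (2) r_def) (simp add: inner_diff_right)
    moreover have "q (v + t *\<^sub>R r) = \<mu> - v \<bullet> f v + t * (2 * \<mu> * (r \<bullet> v) - r \<bullet> f v - v \<bullet> f r) + t\<^sup>2 * q r"
      using vv by (simp add: q_def linear_add[OF f] linear_scale[OF f] inner_simps inner_commute[of v r]
          power2_eq_square algebra_simps)
    ultimately show ?thesis
      by (simp add: \<mu>_def[symmetric] mult.assoc right_diff_distrib)
  qed
  have "r \<bullet> r = 0"
  proof (rule ccontr)
    assume "r \<bullet> r \<noteq> 0"
    then have a: "r \<bullet> r > 0" by (simp add: inner_gt_zero_iff)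
    have c: "q r \<ge> 0" by (rule nonneg[OF r])
    \<comment> \<open>A step against the gradient, short enough for the linear term to beat the quadratic one;
      the \<open>+ 1\<close> covers the case \<open>q r = 0\<close>.\<close>
    define t where "t = - (r \<bullet> r) / (q r + 1)"
    have "0 \<le> q (v + t *\<^sub>R r)"
      using v r S by (intro nonneg subspace_add subspace_scale) auto
    moreover have "t * q r = - (r \<bullet> r) - t"
      using c by (simp add: t_def field_simps)
    then have "q (v + t *\<^sub>R r) = t * ((r \<bullet> r) - t)"
      unfolding expand power2_eq_square mult.assoc by (simp add: right_diff_distrib)
    moreover have "t < 0" using a c by (simp add: t_def divide_neg_pos)
    ultimately show False using a by (smt (verit) mult_neg_pos)
  qed
  then have "f v = \<mu> *\<^sub>R v" by (simp add: r_def)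
  then show ?thesis using that v by auto
qed

text \<open>
  By induction on the dimension: split off one eigenvector. Self-adjointness makes its orthogonal
  complement invariant again.
\<close>

lemma self_adjoint_orthonormal_eigenbasis_of_subspace:
  fixes f :: "'a::euclidean_space \<Rightarrow> 'a"
  assumes f: "linear f" and adj: "\<And>u w. f u \<bullet> w = u \<bullet> f w"
    and S: "subspace S" "f ` S \<subseteq> S"
  shows "\<exists>B\<subseteq>S. finite B \<and> card B = dim S \<and> pairwise orthogonal B \<and>
           (\<forall>b\<in>B. norm b = 1 \<and> (\<exists>\<mu>. f b = \<mu> *\<^sub>R b))"
  using S
proof (induction "dim S" arbitrary: S)
  case 0
  then show ?case by (intro exI[of _ "{}"]) auto
next
  case (Suc n)
  then have "S \<noteq> {0}" by auto
  then obtain v \<mu> where v: "v \<in> S" "norm v = 1" "f v = \<mu> *\<^sub>R v"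
    using self_adjoint_eigenvector_in_subspace[OF f adj Suc.prems] by blast
  define T where "T = {w \<in> S. v \<bullet> w = 0}"
  have "v \<noteq> 0" using v by auto
  have "T = {y \<in> S. \<forall>x \<in> span {v}. orthogonal x y}"
    by (auto simp: T_def span_singleton orthogonal_def dest: spec[of _ 1])
  then have "dim T + dim (span {v}) = dim S"
    using dim_subspace_orthogonal_to_vectors[of "span {v}" S] v Suc.prems
    by (simp add: span_minimal)
  then have dim: "n = dim T" using Suc.hyps(2) \<open>v \<noteq> 0\<close> by (simp add: dim_span)
  have sub: "subspace T"
    using Suc.prems(1) by (auto simp: T_def subspace_def inner_simps)
  have inv: "f ` T \<subseteq> T"
    using Suc.prems(2) v by (auto simp: T_def adj[of v, symmetric])
  from Suc.hyps(1)[OF dim sub inv] obtain B where B: "B \<subseteq> T" "finite B" "card B = n"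
    "pairwise orthogonal B" "\<And>b. b \<in> B \<Longrightarrow> norm b = 1 \<and> (\<exists>\<mu>. f b = \<mu> *\<^sub>R b)"
    using dim by auto
  have "v \<notin> B" using B(1) \<open>v \<noteq> 0\<close> by (auto simp: T_def)
  then show ?case
    using B v Suc.hyps(2)
    by (intro exI[of _ "insert v B"])
      (auto simp: T_def pairwise_insert orthogonal_def inner_commute subset_iff)
qed

lemma self_adjoint_orthonormal_eigenbasis:
  fixes A :: "real ^ 'n ^ 'n"
  assumes adj: "\<And>u w. (A *v u) \<bullet> w = u \<bullet> (A *v w)"
  obtains b :: "'n \<Rightarrow> real ^ 'n" and d :: "'n \<Rightarrow> real"
  where "\<And>i j. b i \<bullet> b j = (if i = j then 1 else 0)" "\<And>i. A *v b i = d i *\<^sub>R b i"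
proof -
  obtain B where B: "finite B" "card B = CARD('n)" "pairwise orthogonal B"
    "\<And>v. v \<in> B \<Longrightarrow> norm v = 1 \<and> (\<exists>\<mu>. A *v v = \<mu> *\<^sub>R v)"
    using self_adjoint_orthonormal_eigenbasis_of_subspace[of "(*v) A" UNIV] adj
    by (auto simp: matrix_vector_mul_linear)
  then obtain b :: "'n \<Rightarrow> real ^ 'n" where b: "bij_betw b UNIV B"
    by (metis finite_class.finite_UNIV finite_same_card_bij)
  then have mem: "b i \<in> B" for i by (auto simp: bij_betw_def)
  obtain d where "\<And>i. A *v b i = d i *\<^sub>R b i"
    using B(4)[OF mem] by metis
  moreover have "b i \<bullet> b j = (if i = j then 1 else 0)" for i j
    using B(4)[OF mem[of i]] B(3) mem b
    by (auto simp: norm_eq_1 pairwise_def orthogonal_def bij_betw_def inj_eq)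
  ultimately show ?thesis using that by blast
qed

section \<open>The ordered eigenvalue list as a spectrum\<close>

text \<open>
  Conjugation by the orthogonal matrix with rows \<open>b i\<close> turns \<open>t I - A\<close> into a diagonal matrix. This is
  done for each real \<open>t\<close> separately, which avoids conjugating over the polynomial ring; real
  polynomials that agree everywhere are equal.
\<close>

lemma charpoly_of_orthonormal_eigenbasis:
  fixes A :: "real ^ 'n ^ 'n" and b :: "'n \<Rightarrow> real ^ 'n"
  assumes orth: "\<And>i j. b i \<bullet> b j = (if i = j then 1 else 0)" and eig: "\<And>i. A *v b i = d i *\<^sub>R b i"
  shows "charpoly A = (\<Prod>i\<in>UNIV. [:- d i, 1:])"
proof -
  define P :: "real ^ 'n ^ 'n" where "P = (\<chi> i. b i)"
  have entry: "(P ** B ** transpose P) $ i $ j = b i \<bullet> (B *v b j)" for B i j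
    by (subst matrix_mul_assoc[symmetric])
      (simp add: P_def matrix_matrix_mult_def transpose_def inner_vec_def matrix_vector_mult_def)
  have "P ** transpose P = mat 1"
    using entry[of "mat 1"] by (simp add: vec_eq_iff orth) (simp add: mat_def)
  then have det1: "det P * det (transpose P) = 1"
    by (metis det_I det_mul)
  have "poly (charpoly A) t = poly (\<Prod>i\<in>UNIV. [:- d i, 1:]) t" for t
  proof -
    let ?D = "P ** (mat t - A) ** transpose P"
    have "mat t = t *\<^sub>R (mat 1 :: real ^ 'n ^ 'n)"
      by (simp add: vec_eq_iff mat_def)
    then have "(mat t - A) *v b j = (t - d j) *\<^sub>R b j" for j
      by (simp add: matrix_vector_mult_diff_rdistrib scaleR_matrix_vector_assoc[symmetric] eig
          scaleR_left_diff_distrib)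
    then have D: "?D $ i $ j = (if i = j then t - d i else 0)" for i j
      by (simp add: entry orth)
    have "det (mat t - A) = det ?D"
      using det1 by (simp add: det_mul mult.commute mult.left_commute)
    also have "\<dots> = (\<Prod>i\<in>UNIV. t - d i)"
      by (subst det_diagonal) (simp_all add: D)
    finally show ?thesis by (simp add: poly_charpoly poly_prod)
  qed
  then show ?thesis by (simp add: poly_eq_poly_eq_iff[symmetric] fun_eq_iff)
qed

lemma proots_prod_linear:
  fixes d :: "'i \<Rightarrow> 'a::idom"
  assumes "finite I"
  shows "proots (\<Prod>i\<in>I. [:- d i, 1:]) = image_mset d (mset_set I)"
  using assms
proof (induction I)
  case (insert i I)
  have "(\<Prod>i\<in>I. [:- d i, 1:]) \<noteq> 0"
    using insert.hyps by (simp add: prod_zero_iff)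
  then show ?case using insert by (simp add: proots_mult del: mult_pCons_left)
qed simp

text \<open>
  Algebraic multiplicities are counted by the characteristic polynomial, geometric ones by an
  eigenbasis. The factorisation above identifies them, so the eigenbasis can be enumerated along the
  ordered list of eigenvalues.
\<close>

theorem spectral_theorem_eigenvalues:
  fixes A :: "real ^ 'n ^ 'n"
  assumes "\<And>u w. (A *v u) \<bullet> w = u \<bullet> (A *v w)"
  obtains b :: "nat \<Rightarrow> real ^ 'n"
  where "\<And>k l. k < CARD('n) \<Longrightarrow> l < CARD('n) \<Longrightarrow> b k \<bullet> b l = (if k = l then 1 else 0)"
    and "\<And>k. k < CARD('n) \<Longrightarrow> A *v b k = (eigenvalues A ! k) *\<^sub>R b k"
    and "\<And>k l. k \<le> l \<Longrightarrow> l < CARD('n) \<Longrightarrow> eigenvalues A ! l \<le> eigenvalues A ! k"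
proof -
  obtain b d where orth: "\<And>i j::'n. b i \<bullet> b j = (if i = j then 1 else 0)"
    and eig: "\<And>i. A *v b i = d i *\<^sub>R b i"
    using self_adjoint_orthonormal_eigenbasis[of A] assms by blast
  obtain os where os: "set os = (UNIV :: 'n set)" "distinct os"
    using finite_distinct_list[OF finite_class.finite_UNIV] by blast
  define js where "js = rev (sort_key d os)"
  have "proots (charpoly A) = mset (map d os)"
    using os by (simp add: charpoly_of_orthonormal_eigenbasis[OF orth eig] proots_prod_linear
        mset_set_set[symmetric])
  then have "sorted_list_of_multiset (proots (charpoly A)) = map d (sort_key d os)"
    by (simp only: sorted_list_of_multiset_mset) (rule properties_for_sort, simp_all)
  then have ev: "eigenvalues A = map d js"
    by (simp add: eigenvalues_def js_def rev_map)
  have len: "length js = CARD('n)"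
    using os by (metis js_def distinct_card length_rev length_sort)
  have dist: "distinct js" using os by (simp add: js_def)
  have sorted: "sorted (rev (eigenvalues A))" by (simp add: eigenvalues_def)
  show ?thesis
  proof (rule that[of "\<lambda>k. b (js ! k)"])
    show "b (js ! k) \<bullet> b (js ! l) = (if k = l then 1 else 0)" if "k < CARD('n)" "l < CARD('n)" for k l
      using that dist len by (simp add: orth nth_eq_iff_index_eq)
    show "A *v b (js ! k) = (eigenvalues A ! k) *\<^sub>R b (js ! k)" if "k < CARD('n)" for k
      using that len by (simp add: ev eig)
    show "eigenvalues A ! l \<le> eigenvalues A ! k" if "k \<le> l" "l < CARD('n)" for k l
      using sorted_rev_nth_mono[OF sorted] that len ev by simp
  qed
qed

section \<open>Weyl's perturbation inequality\<close>

lemma orthonormal_expansion: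
  fixes b :: "'i \<Rightarrow> 'a::euclidean_space"
  assumes J: "finite J" and orth: "\<And>k l. k \<in> J \<Longrightarrow> l \<in> J \<Longrightarrow> b k \<bullet> b l = (if k = l then 1 else 0)"
  shows "inj_on b J" and "dim (span (b ` J)) = card J"
    and "v \<in> span (b ` J) \<Longrightarrow> \<exists>c. v = (\<Sum>k\<in>J. c k *\<^sub>R b k)"
proof -
  show inj: "inj_on b J"
    using orth by (intro inj_onI) (metis zero_neq_one)
  have "independent (b ` J)"
  proof (rule pairwise_orthogonal_independent)
    show "pairwise orthogonal (b ` J)"
      using orth by (auto simp: pairwise_def orthogonal_def)
    show "0 \<notin> b ` J"
      using orth by (metis imageE inner_zero_left zero_neq_one)
  qed
  then show "dim (span (b ` J)) = card J"
    by (simp add: dim_span dim_eq_card_independent card_image inj)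
  show "\<exists>c. v = (\<Sum>k\<in>J. c k *\<^sub>R b k)" if v: "v \<in> span (b ` J)"
  proof -
    obtain u where "v = (\<Sum>w\<in>b ` J. u w *\<^sub>R w)"
      using v J by (auto simp: span_finite)
    then have "v = (\<Sum>k\<in>J. u (b k) *\<^sub>R b k)"
      by (simp add: sum.reindex[OF inj])
    then show ?thesis by (rule exI[of _ "\<lambda>k. u (b k)"])
  qed
qed

lemma inner_orthonormal_sums:
  fixes b :: "'i \<Rightarrow> 'a::euclidean_space"
  assumes J: "finite J" and orth: "\<And>k l. k \<in> J \<Longrightarrow> l \<in> J \<Longrightarrow> b k \<bullet> b l = (if k = l then 1 else 0)"
  shows "(\<Sum>k\<in>J. a k *\<^sub>R b k) \<bullet> (\<Sum>k\<in>J. c k *\<^sub>R b k) = (\<Sum>k\<in>J. a k * c k)"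
proof -
  have "(\<Sum>k\<in>J. a k *\<^sub>R b k) \<bullet> (\<Sum>k\<in>J. c k *\<^sub>R b k) = (\<Sum>k\<in>J. \<Sum>l\<in>J. a k * (c l * (b k \<bullet> b l)))"
    unfolding inner_sum_left by (simp add: inner_sum_right sum_distrib_left mult.left_commute)
  also have "\<dots> = (\<Sum>k\<in>J. \<Sum>l\<in>J. if k = l then a k * c l else 0)"
    by (intro sum.cong refl) (simp add: orth)
  also have "\<dots> = (\<Sum>k\<in>J. a k * c k)"
    using J by (simp add: sum.delta')
  finally show ?thesis .
qed

text \<open>
  In eigencoordinates \<open>c\<close> the form is \<open>\<Sum> m\<^sub>k c\<^sub>k\<^sup>2\<close>, while \<open>v \<bullet> v\<close> is \<open>\<Sum> c\<^sub>k\<^sup>2\<close>. Each bound is one half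
  of the Courant--Fischer characterisation of eigenvalues.
\<close>

lemma quadratic_form_on_eigenspan:
  fixes A :: "real ^ 'n ^ 'n"
  assumes J: "finite J" and orth: "\<And>k l. k \<in> J \<Longrightarrow> l \<in> J \<Longrightarrow> b k \<bullet> b l = (if k = l then 1 else 0)"
    and eig: "\<And>k. k \<in> J \<Longrightarrow> A *v b k = m k *\<^sub>R b k" and v: "v \<in> span (b ` J)"
  shows "(\<And>k. k \<in> J \<Longrightarrow> m k \<le> t) \<Longrightarrow> v \<bullet> (A *v v) \<le> t * (v \<bullet> v)"
    and "(\<And>k. k \<in> J \<Longrightarrow> t \<le> m k) \<Longrightarrow> t * (v \<bullet> v) \<le> v \<bullet> (A *v v)"
proof -
  obtain c where c: "v = (\<Sum>k\<in>J. c k *\<^sub>R b k)"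
    using orthonormal_expansion(3)[OF J orth v] by blast
  have "A *v v = (\<Sum>k\<in>J. A *v (c k *\<^sub>R b k))"
    unfolding c by (rule linear_sum) simp
  also have "\<dots> = (\<Sum>k\<in>J. (m k * c k) *\<^sub>R b k)"
    by (intro sum.cong refl) (simp add: matrix_vector_mult_scaleR eig mult.commute)
  finally have Av: "v \<bullet> (A *v v) = (\<Sum>k\<in>J. m k * (c k)\<^sup>2)"
    using inner_orthonormal_sums[OF J orth, of c "\<lambda>k. m k * c k"]
    by (simp add: c power2_eq_square mult.left_commute)
  have vv: "v \<bullet> v = (\<Sum>k\<in>J. (c k)\<^sup>2)"
    using inner_orthonormal_sums[OF J orth, of c c] by (simp add: c power2_eq_square)
  show "v \<bullet> (A *v v) \<le> t * (v \<bullet> v)" if "\<And>k. k \<in> J \<Longrightarrow> m k \<le> t"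
    using that by (auto simp: Av vv sum_distrib_left intro!: sum_mono mult_right_mono)
  show "t * (v \<bullet> v) \<le> v \<bullet> (A *v v)" if "\<And>k. k \<in> J \<Longrightarrow> t \<le> m k"
    using that by (auto simp: Av vv sum_distrib_left intro!: sum_mono mult_right_mono)
qed

text \<open>
  The dimensions \<open>n - j\<close> and \<open>j + 1\<close> of the two eigenspans exceed \<open>n\<close> together, so some nonzero \<open>v\<close>
  has Rayleigh quotient at most \<open>eigenvalues A ! j\<close> for \<open>A\<close> and at least \<open>eigenvalues B ! j\<close>
  for \<open>B\<close>. Hence \<open>B - A\<close> stretches \<open>v\<close> by at least the difference.
\<close>

lemma weyl_one_sided:
  fixes A B :: "real ^ 'n ^ 'n"
  assumes A: "\<And>u w. (A *v u) \<bullet> w = u \<bullet> (A *v w)" and B: "\<And>u w. (B *v u) \<bullet> w = u \<bullet> (B *v w)"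
    and j: "j < CARD('n)"
  shows "eigenvalues B ! j - eigenvalues A ! j \<le> onorm ((*v) (B - A))"
proof -
  let ?n = "CARD('n)"
  obtain a where a: "\<And>k l. k < ?n \<Longrightarrow> l < ?n \<Longrightarrow> a k \<bullet> a l = (if k = l then 1 else 0)"
    "\<And>k. k < ?n \<Longrightarrow> A *v a k = (eigenvalues A ! k) *\<^sub>R a k"
    "\<And>k l. k \<le> l \<Longrightarrow> l < ?n \<Longrightarrow> eigenvalues A ! l \<le> eigenvalues A ! k"
    using spectral_theorem_eigenvalues[of A] A by metis
  obtain b where b: "\<And>k l. k < ?n \<Longrightarrow> l < ?n \<Longrightarrow> b k \<bullet> b l = (if k = l then 1 else 0)"
    "\<And>k. k < ?n \<Longrightarrow> B *v b k = (eigenvalues B ! k) *\<^sub>R b k"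
    "\<And>k l. k \<le> l \<Longrightarrow> l < ?n \<Longrightarrow> eigenvalues B ! l \<le> eigenvalues B ! k"
    using spectral_theorem_eigenvalues[of B] B by metis
  \<comment> \<open>Both eigenspans contain index \<open>j\<close>, which makes their dimensions add up to \<open>n + 1\<close>.\<close>
  define S where "S = span (a ` {j..<?n})"
  define T where "T = span (b ` {..j})"
  have "dim S = ?n - j" "dim T = Suc j"
    using orthonormal_expansion(2)[of "{j..<?n}" a] orthonormal_expansion(2)[of "{..j}" b] a(1) b(1) j
    by (simp_all add: S_def T_def del: dim_span)
  moreover have "dim {x + y |x y. x \<in> S \<and> y \<in> T} + dim (S \<inter> T) = dim S + dim T"
    by (rule dim_sums_Int) (simp_all add: S_def T_def)
  moreover have "dim {x + y |x y. x \<in> S \<and> y \<in> T} \<le> ?n"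
    by (rule order_trans[OF dim_subset_UNIV]) simp
  ultimately have "dim (S \<inter> T) \<noteq> 0" using j by linarith
  then obtain v where v: "v \<in> S" "v \<in> T" "v \<noteq> 0" by (auto simp: dim_eq_0)
  have "v \<bullet> (A *v v) \<le> eigenvalues A ! j * (v \<bullet> v)"
    by (rule quadratic_form_on_eigenspan(1)[OF _ _ _ v(1)[unfolded S_def]]) (use a in auto)
  moreover have "eigenvalues B ! j * (v \<bullet> v) \<le> v \<bullet> (B *v v)"
    by (rule quadratic_form_on_eigenspan(2)[OF _ _ _ v(2)[unfolded T_def]]) (use b j in auto)
  ultimately have "(eigenvalues B ! j - eigenvalues A ! j) * (v \<bullet> v) \<le> v \<bullet> ((B - A) *v v)"
    by (simp add: matrix_vector_mult_diff_rdistrib inner_diff_right left_diff_distrib)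
  also have "\<dots> \<le> norm v * norm ((B - A) *v v)"
    by (rule norm_cauchy_schwarz)
  also have "\<dots> \<le> norm v * (onorm ((*v) (B - A)) * norm v)"
    by (intro mult_left_mono onorm matrix_vector_mul_bounded_linear norm_ge_zero)
  also have "\<dots> = onorm ((*v) (B - A)) * (v \<bullet> v)"
    by (simp add: dot_square_norm power2_eq_square)
  finally show ?thesis using v(3) by simp
qed

theorem weyl_perturbation:
  fixes A B :: "real ^ 'n ^ 'n"
  assumes A: "\<And>u w. (A *v u) \<bullet> w = u \<bullet> (A *v w)" and B: "\<And>u w. (B *v u) \<bullet> w = u \<bullet> (B *v w)"
    and j: "j < CARD('n)"
  shows "\<bar>eigenvalues B ! j - eigenvalues A ! j\<bar> \<le> onorm ((*v) (B - A))"
proof -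
  have "(*v) (A - B) = (\<lambda>u. - ((B - A) *v u))"
    by (simp add: fun_eq_iff matrix_vector_mult_diff_rdistrib)
  then have "onorm ((*v) (A - B)) = onorm ((*v) (B - A))"
    by (simp add: onorm_neg)
  then show ?thesis
    using weyl_one_sided[of A B j] weyl_one_sided[of B A j] A B j by (auto simp: abs_le_iff)
qed

section \<open>Perturbation of the sample covariance\<close>

lemma outer_mult_vec: "outer u v *v w = (v \<bullet> w) *\<^sub>R u"
  by (simp add: outer_def matrix_vector_mult_def inner_vec_def vec_eq_iff sum_distrib_left
      sum_distrib_right mult_ac)

lemma sample_cov_mult_vec:
  "sample_cov N x *v w = (1 / (real N - 1)) *\<^sub>R (\<Sum>s=1..N. (x s \<bullet> w) *\<^sub>R x s)"
proof -
  have "(\<Sum>s\<in>I. outer (x s) (x s)) *v w = (\<Sum>s\<in>I. (x s \<bullet> w) *\<^sub>R x s)" for I :: "nat set"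
    by (induction I rule: infinite_finite_induct)
      (simp_all add: matrix_vector_mult_add_rdistrib outer_mult_vec)
  then show ?thesis
    by (simp add: sample_cov_def scaleR_matrix_vector_assoc[symmetric])
qed

lemma sample_cov_self_adjoint: "(sample_cov N x *v u) \<bullet> w = u \<bullet> (sample_cov N x *v w)"
  by (simp add: sample_cov_mult_vec inner_sum_left inner_sum_right inner_commute mult.commute)

text \<open>
  With \<open>e = y - x\<close>, the two terms linear in \<open>e\<close> give the factor 2 and the quadratic term the square.
\<close>

lemma norm_rank_one_perturbation:
  fixes x y u :: "'a::real_inner"
  shows "norm ((y \<bullet> u) *\<^sub>R y - (x \<bullet> u) *\<^sub>R x)
           \<le> (2 * (norm x * norm (y - x)) + (norm (y - x))\<^sup>2) * norm u"
proof -
  define e where "e = y - x"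
  have "(y \<bullet> u) *\<^sub>R y - (x \<bullet> u) *\<^sub>R x = (x \<bullet> u) *\<^sub>R e + (e \<bullet> u) *\<^sub>R x + (e \<bullet> u) *\<^sub>R e"
    by (simp add: e_def algebra_simps inner_diff_left)
  also have "norm \<dots> \<le> \<bar>x \<bullet> u\<bar> * norm e + \<bar>e \<bullet> u\<bar> * norm x + \<bar>e \<bullet> u\<bar> * norm e"
    by (metis add_mono norm_triangle_le norm_triangle_ineq norm_scaleR order_refl)
  also have "\<dots> \<le> (norm x * norm u) * norm e + (norm e * norm u) * norm x + (norm e * norm u) * norm e"
    by (intro add_mono mult_right_mono Cauchy_Schwarz_ineq2 norm_ge_zero)
  finally show ?thesis by (simp add: e_def power2_eq_square algebra_simps)
qed

text \<open>
  The rank-one bounds add up to \<open>2 \<Sum> \<bar>x\<^sub>s\<bar> \<bar>e\<^sub>s\<bar> + \<Sum> \<bar>e\<^sub>s\<bar>\<^sup>2\<close> with \<open>e\<^sub>s = y\<^sub>s - x\<^sub>s\<close>. By Cauchy--Schwarz the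
  cross term is at most \<open>N \<surd>M \<epsilon>\<close>. The averages in the hypotheses divide by \<open>N\<close> but the covariance
  by \<open>N - 1\<close>, whence the factor \<open>N / (N - 1)\<close>.
\<close>

lemma sample_cov_perturbation:
  fixes x y :: "nat \<Rightarrow> real ^ 'n"
  assumes N: "N \<ge> 2" and e: "\<epsilon> > 0"
    and x: "(1 / real N) * (\<Sum>s=1..N. (norm (x s))\<^sup>2) \<le> M"
    and y: "(1 / real N) * (\<Sum>s=1..N. (norm (y s - x s))\<^sup>2) \<le> \<epsilon>\<^sup>2"
  shows "onorm ((*v) (sample_cov N y - sample_cov N x))
           \<le> real N / (real N - 1) * (2 * sqrt M * \<epsilon> + \<epsilon>\<^sup>2)"
proof (rule onorm_le)
  fix u :: "real ^ 'n"
  let ?X = "\<Sum>s=1..N. (norm (x s))\<^sup>2" and ?E = "\<Sum>s=1..N. (norm (y s - x s))\<^sup>2"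
  let ?C = "\<Sum>s=1..N. norm (x s) * norm (y s - x s)"
  have X: "?X \<le> real N * M" and E: "?E \<le> real N * \<epsilon>\<^sup>2"
    using x y N by (simp_all add: field_simps)
  have "?C \<le> L2_set (\<lambda>s. norm (x s)) {1..N} * L2_set (\<lambda>s. norm (y s - x s)) {1..N}"
    using L2_set_mult_ineq[of "\<lambda>s. norm (x s)" "\<lambda>s. norm (y s - x s)" "{1..N}"] by simp
  also have "\<dots> \<le> sqrt (real N * M) * sqrt (real N * \<epsilon>\<^sup>2)"
    unfolding L2_set_def using X E
    by (intro mult_mono real_sqrt_le_mono real_sqrt_ge_zero sum_nonneg)
      (auto intro: order_trans[OF sum_nonneg X])
  also have "\<dots> = real N * (sqrt M * \<epsilon>)"
    using e by (simp add: real_sqrt_mult)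
  finally have C: "?C \<le> real N * (sqrt M * \<epsilon>)" .
  have "norm (\<Sum>s=1..N. (y s \<bullet> u) *\<^sub>R y s - (x s \<bullet> u) *\<^sub>R x s)
      \<le> (\<Sum>s=1..N. (2 * (norm (x s) * norm (y s - x s)) + (norm (y s - x s))\<^sup>2) * norm u)"
    by (intro sum_norm_le norm_rank_one_perturbation)
  also have "\<dots> = (2 * ?C + ?E) * norm u"
    by (simp add: sum_distrib_right[symmetric] sum.distrib sum_distrib_left[symmetric])
  also have "\<dots> \<le> (real N * (2 * sqrt M * \<epsilon> + \<epsilon>\<^sup>2)) * norm u"
    using C E by (intro mult_right_mono) (auto simp: algebra_simps)
  finally have sum: "norm (\<Sum>s=1..N. (y s \<bullet> u) *\<^sub>R y s - (x s \<bullet> u) *\<^sub>R x s)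
      \<le> (real N * (2 * sqrt M * \<epsilon> + \<epsilon>\<^sup>2)) * norm u" .
  have "norm ((sample_cov N y - sample_cov N x) *v u)
      = (1 / (real N - 1)) * norm (\<Sum>s=1..N. (y s \<bullet> u) *\<^sub>R y s - (x s \<bullet> u) *\<^sub>R x s)"
    using N by (simp add: matrix_vector_mult_diff_rdistrib sample_cov_mult_vec sum_subtractf
        scaleR_right_diff_distrib[symmetric] del: scaleR_right_diff_distrib)
  also have "\<dots> \<le> (1 / (real N - 1)) * ((real N * (2 * sqrt M * \<epsilon> + \<epsilon>\<^sup>2)) * norm u)"
    using N by (intro mult_left_mono sum) auto
  finally show "norm ((sample_cov N y - sample_cov N x) *v u)
      \<le> real N / (real N - 1) * (2 * sqrt M * \<epsilon> + \<epsilon>\<^sup>2) * norm u"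
    by simp
qed

theorem theorem4p1:
  fixes N :: nat
    and x xhat :: "nat \<Rightarrow> real ^ 'n"
    and M\<^sub>x \<epsilon> :: real
  assumes "N \<ge> 2"
    and "M\<^sub>x > 0"
    and "\<epsilon> > 0"
    and "(1 / real N) * (\<Sum>s=1..N. (norm (x s))\<^sup>2) \<le> M\<^sub>x"
    and "(1 / real N) * (\<Sum>s=1..N. (norm (xhat s - x s))\<^sup>2) \<le> \<epsilon>\<^sup>2"
  shows "onorm ((*v) (sample_cov N xhat - sample_cov N x))
           \<le> real N / (real N - 1) * (2 * sqrt M\<^sub>x * \<epsilon> + \<epsilon>\<^sup>2)
       \<and> (\<forall>j < CARD('n). \<bar>eigenvalues (sample_cov N xhat) ! j - eigenvalues (sample_cov N x) ! j\<bar>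
           \<le> real N / (real N - 1) * (2 * sqrt M\<^sub>x * \<epsilon> + \<epsilon>\<^sup>2))"
proof -
  have bound: "onorm ((*v) (sample_cov N xhat - sample_cov N x))
      \<le> real N / (real N - 1) * (2 * sqrt M\<^sub>x * \<epsilon> + \<epsilon>\<^sup>2)"
    by (rule sample_cov_perturbation) (use assms in auto)
  moreover have "\<bar>eigenvalues (sample_cov N xhat) ! j - eigenvalues (sample_cov N x) ! j\<bar>
      \<le> onorm ((*v) (sample_cov N xhat - sample_cov N x))" if "j < CARD('n)" for j
    by (rule weyl_perturbation) (simp_all add: sample_cov_self_adjoint that)
  ultimately show ?thesis by (meson order_trans)
qed

end
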